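(* Let $G,H$ be locally compact Polish groups, and let $X$ be a locally compact Polish space. Suppose that $G$ acts on $X$ continuously, and let $c:G\times X\to H$ be a cocycle with respect to this action such that $x\mapsto c(g,x)$ is continuous for every $g\in G$ and such that $g\mapsto c(g,x)$ is Haar measurable for every $x\in X$. Then $c:G\times X\to H$ is continuous (with respect to the product topology on $G\times X$).
   Context: Groups are written multiplicatively and are not assumed commutative. A continuous action of $G$ on $X$ is a homomorphism from $G$ into the group of homeomorphisms of $X$ such that the map $G\times X\to X$, $(g,x)\mapsto g\cdot x$, is continuous. A cocycle with respect to this action is a function $c:G\times X\to H$ satisfying $$c(g_1g_2,x)=c(g_1,g_2\cdot x)\,c(g_2,x)\quad\text{for all } g_1,g_2\in G,\ x\in X.$$ A function $G\to H$ is Haar measurable if the preimage of every open set is a Haar measurable subset of $G$, i.e. measurable with respect to the completion of Haar measure on the Borel sets of $G$. *)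

theory Defs
  imports "HOL-Analysis.Analysis"
begin

text \<open>
  Topological groups are types of the library class \<open>topological_group_add\<close>, which is based on
  \<open>group_add\<close> and hence does not assume commutativity. The group law is therefore written \<open>+\<close>, and
  the order of summands matters.
  A Polish space is a type of class \<open>polish_space\<close>; the complete metric that this class carries
  enters below only through its topology.
\<close>

definition continuous_action ::
    "('g::topological_group_add \<Rightarrow> 'x::topological_space \<Rightarrow> 'x) \<Rightarrow> bool" where
  "continuous_action \<alpha> \<longleftrightarrow>
     (\<forall>g. homeomorphic_map euclidean euclidean (\<alpha> g)) \<and>
     (\<forall>g h. \<alpha> (g + h) = \<alpha> g \<circ> \<alpha> h) \<and>
     continuous_on UNIV (\<lambda>(g, x). \<alpha> g x)"

definition cocycle ::
    "('g::group_add \<Rightarrow> 'x \<Rightarrow> 'x) \<Rightarrow> ('g \<times> 'x \<Rightarrow> 'h::group_add) \<Rightarrow> bool" where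
  "cocycle \<alpha> c \<longleftrightarrow> (\<forall>g\<^sub>1 g\<^sub>2 x. c (g\<^sub>1 + g\<^sub>2, x) = c (g\<^sub>1, \<alpha> g\<^sub>2 x) + c (g\<^sub>2, x))"

text \<open>
  Left Haar measures. No regularity condition is imposed: on a locally compact Polish group every
  Borel measure that is finite on compact sets is regular.
\<close>

definition haar_measure :: "'g::topological_group_add measure \<Rightarrow> bool" where
  "haar_measure \<mu> \<longleftrightarrow>
     sets \<mu> = sets borel \<and>
     emeasure \<mu> UNIV \<noteq> 0 \<and>
     (\<forall>K. compact K \<longrightarrow> emeasure \<mu> K < \<infinity>) \<and>
     (\<forall>g. \<forall>A\<in>sets borel. emeasure \<mu> ((\<lambda>x. g + x) ` A) = emeasure \<mu> A)"

text \<open>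
  Haar measures are unique up to a positive scalar, so the following notion does not depend on the
  choice of the Haar measure \<open>\<mu>\<close>.
\<close>

definition haar_measurable ::
    "'g::topological_group_add measure \<Rightarrow> ('g \<Rightarrow> 'h::topological_space) \<Rightarrow> bool" where
  "haar_measurable \<mu> f \<longleftrightarrow> (\<forall>U. open U \<longrightarrow> f -` U \<in> sets (completion \<mu>))"

end

theory Submission
  imports Defs
begin

text \<open>
  If \<open>g\<^sub>n \<longlonglongrightarrow> 0\<close> and \<open>x\<^sub>n \<longlonglongrightarrow> x\<close>, put \<open>y\<^sub>n = \<alpha> g\<^sub>n x\<^sub>n\<close>. The cocycle identity gives
  \<open>c (g\<^sub>n, x\<^sub>n) = - c (- (g\<^sub>n + k), y\<^sub>n) + c (- k, x\<^sub>n)\<close> for every \<open>k\<close>. As \<open>n\<close> grows, the functions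
  \<open>k \<mapsto> c (- k, x\<^sub>n)\<close> and \<open>k \<mapsto> c (- k, y\<^sub>n)\<close> tend pointwise to \<open>k \<mapsto> c (- k, x)\<close>. Hence \<open>G\<close> is a
  countable union of measurable sets on each of which both functions eventually take
  all their values in one small open set. One of these sets, \<open>B\<close>, is not null. By Steinhaus, \<open>B\<close> meets
  \<open>- g\<^sub>n + B\<close> for large \<open>n\<close>, so \<open>c (g\<^sub>n, x\<^sub>n)\<close> is close to \<open>0\<close>. Continuity elsewhere follows from the
  cocycle identity and the continuity of \<open>c (g, \<cdot>)\<close>.
\<close>

section \<open>Countable open covers by sets of finite Haar measure\<close>

text \<open>Local compactness puts around every point an open set inside a compact one, where a Haar
  measure is finite; Lindelof reduces this cover to a countable one.\<close>

lemma haar_measure_cover: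
  fixes \<mu> :: "'g::{topological_group_add, second_countable_topology, t2_space} measure"
  assumes "locally_compact_space (euclidean :: 'g topology)" and "haar_measure \<mu>"
  obtains \<F> :: "'g set set" where "countable \<F>" "\<Union>\<F> = UNIV"
    "\<And>S. S \<in> \<F> \<Longrightarrow> open S" "\<And>S. S \<in> \<F> \<Longrightarrow> emeasure \<mu> S < \<infinity>"
proof -
  let ?\<F> = "{S :: 'g set. open S \<and> (\<exists>K. compact K \<and> S \<subseteq> K)}"
  have "\<Union>?\<F> = UNIV"
    using assms(1) unfolding locally_compact_space_def by simp blast
  moreover have "\<And>S. S \<in> ?\<F> \<Longrightarrow> open S"
    by simp
  then obtain \<F>' where "\<F>' \<subseteq> ?\<F>" "countable \<F>'" "\<Union>\<F>' = \<Union>?\<F>"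
    by (rule Lindelof)
  moreover have "emeasure \<mu> S < \<infinity>" if K: "compact K" "S \<subseteq> K" for S K
  proof -
    have "emeasure \<mu> S \<le> emeasure \<mu> K"
      using K assms(2) by (intro emeasure_mono) (auto simp: haar_measure_def borel_compact)
    also have "\<dots> < \<infinity>"
      using K assms(2) by (auto simp: haar_measure_def)
    finally show ?thesis .
  qed
  ultimately show thesis
    by (intro that[of \<F>']) (simp_all add: subset_iff, metis+)
qed

lemma haar_measure_sigma_finite:
  fixes \<mu> :: "'g::{topological_group_add, second_countable_topology, t2_space} measure"
  assumes "locally_compact_space (euclidean :: 'g topology)" and "haar_measure \<mu>"
  shows "sigma_finite_measure \<mu>"
proof -
  have sets: "sets \<mu> = sets borel"
    using assms(2) by (simp add: haar_measure_def)
  then have "space \<mu> = UNIV"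
    using sets_eq_imp_space_eq by fastforce
  moreover obtain \<F> :: "'g set set" where "countable \<F>" "\<Union>\<F> = UNIV"
    "\<And>S. S \<in> \<F> \<Longrightarrow> open S" "\<And>S. S \<in> \<F> \<Longrightarrow> emeasure \<mu> S < \<infinity>"
    using haar_measure_cover[OF assms] by metis
  ultimately show ?thesis
    using sets by (intro sigma_finite_measure.intro exI[of _ \<F>]) (auto simp: less_top)
qed

section \<open>Inversion and Haar null sets\<close>

lemma borel_measurable_uminus_group:
  "(uminus :: 'g::topological_group_add \<Rightarrow> 'g) \<in> borel_measurable borel"
  by (intro borel_measurable_continuous_onI continuous_on_minus continuous_on_id)

text \<open>
  With \<open>A = - N\<close>, the set of all \<open>(x, y)\<close> such that \<open>- x + y \<in> N\<close> has the sections \<open>x + N\<close> and \<open>y + A\<close>,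
  so Tonelli gives \<open>\<mu> A \<cdot> \<mu> UNIV = 0\<close> if \<open>\<mu> N = 0\<close>.
\<close>

lemma haar_null_uminus:
  fixes \<mu> :: "'g::{topological_group_add, second_countable_topology, t2_space} measure"
  assumes lc: "locally_compact_space (euclidean :: 'g topology)" and haar: "haar_measure \<mu>"
    and N: "N \<in> null_sets \<mu>"
  shows "uminus -` N \<in> null_sets \<mu>"
proof -
  interpret sigma_finite_measure \<mu>
    by (rule haar_measure_sigma_finite[OF lc haar])
  interpret P: pair_sigma_finite \<mu> \<mu> ..
  have sets [measurable_cong]: "sets \<mu> = sets borel"
    using haar by (simp add: haar_measure_def)
  have space: "space \<mu> = UNIV"
    using sets sets_eq_imp_space_eq by fastforce
  have transl: "emeasure \<mu> ((+) g ` A) = emeasure \<mu> A" if "A \<in> sets borel" for g A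
    using haar that by (simp add: haar_measure_def)
  have N': "N \<in> sets borel"
    using N sets by auto
  have A: "uminus -` N \<in> sets borel"
    using measurable_sets[OF borel_measurable_uminus_group N'] by simp
  define E where "E = (\<lambda>(x, y). - x + y) -` N"
  have "(\<lambda>(x :: 'g, y). - x + y) \<in> borel_measurable borel"
    unfolding case_prod_beta
    by (intro borel_measurable_continuous_onI continuous_intros)
  then have "E \<in> sets borel"
    using N' measurable_sets_borel unfolding E_def by blast
  then have E: "E \<in> sets (\<mu> \<Otimes>\<^sub>M \<mu>)"
    unfolding sets_pair_measure_cong[OF sets sets] borel_prod .
  have "Pair x -` E = (+) x ` N" for x
    by (auto simp: E_def image_iff add.assoc[symmetric] intro!: bexI[of _ "- x + _"])
  then have "emeasure (\<mu> \<Otimes>\<^sub>M \<mu>) E = 0"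
    using N transl[OF N'] by (simp add: emeasure_pair_measure_alt[OF E] null_setsD1)
  moreover have "(\<lambda>x. (x, y)) -` E = (+) y ` (uminus -` N)" for y
    by (auto simp: E_def image_iff add.assoc[symmetric] minus_add intro!: bexI[of _ "- y + _"])
  then have "emeasure (\<mu> \<Otimes>\<^sub>M \<mu>) E = emeasure \<mu> (uminus -` N) * emeasure \<mu> UNIV"
    using transl[OF A] by (simp add: P.emeasure_pair_measure_alt2[OF E] space)
  ultimately have "emeasure \<mu> (uminus -` N) = 0"
    using haar by (auto simp: haar_measure_def)
  then show ?thesis
    using A sets by auto
qed

text \<open>A left Haar measure may change under inversion, but its null sets stay null. That
  suffices, since a set of the completion is Borel up to a subset of a null set.\<close>

lemma haar_completion_uminus:
  fixes \<mu> :: "'g::{topological_group_add, second_countable_topology, t2_space} measure"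
  assumes lc: "locally_compact_space (euclidean :: 'g topology)" and haar: "haar_measure \<mu>"
    and A: "A \<in> sets (completion \<mu>)"
  shows "uminus -` A \<in> sets (completion \<mu>)"
proof -
  have sets: "sets \<mu> = sets borel"
    using haar by (simp add: haar_measure_def)
  obtain S N N' where *: "A = S \<union> N" "N \<subseteq> N'" "N' \<in> null_sets \<mu>" "S \<in> sets \<mu>"
    using A by (rule sets_completionE)
  have "uminus -` S \<in> sets \<mu>"
    using measurable_sets[OF borel_measurable_uminus_group, of S] * sets by simp
  then show ?thesis
    using * haar_null_uminus[OF lc haar *(3)]
    by (intro sets_completionI[of _ "uminus -` S" "uminus -` N" "uminus -` N'"]) auto
qed

section \<open>Steinhaus for Haar measure\<close>

lemma eventually_translate_subset:
  fixes K U :: "'g::topological_group_add set"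
  assumes "compact K" "open U" "K \<subseteq> U"
  shows "\<forall>\<^sub>F g in nhds 0. (+) g ` K \<subseteq> U"
proof -
  have "open ((\<lambda>z. fst z + snd z) -` U)"
    by (intro open_vimage assms continuous_intros)
  moreover have "{0} \<times> K \<subseteq> (\<lambda>z. fst z + snd z) -` U"
    using assms(3) by auto
  ultimately have "\<exists>T. 0 \<in> T \<and> open T \<and> T \<times> K \<subseteq> (\<lambda>z. fst z + snd z) -` U"
    by (rule Elementary_Topology.tube_lemma[OF assms(1)])
  then obtain T where "0 \<in> T" "open T" "T \<times> K \<subseteq> (\<lambda>z. fst z + snd z) -` U"
    by blast
  then show ?thesis
    unfolding eventually_nhds by (intro exI[of _ T]) auto
qed

text \<open>Inside \<open>B\<close> sits a compact \<open>K\<close> of positive measure, and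
  \<open>K\<close> has an open neighbourhood of measure below \<open>2 * emeasure \<mu> K\<close>.
  For \<open>g\<close> near \<open>0\<close> the translate of \<open>K\<close> stays in that
  neighbourhood, which has no room for two disjoint copies of \<open>K\<close>.\<close>

lemma haar_steinhaus:
  fixes \<mu> :: "'g::{topological_group_add, polish_space} measure"
  assumes lc: "locally_compact_space (euclidean :: 'g topology)" and haar: "haar_measure \<mu>"
    and B: "B \<in> sets (completion \<mu>)" "emeasure (completion \<mu>) B \<noteq> 0"
  shows "\<forall>\<^sub>F g in nhds 0. \<exists>k\<in>B. g + k \<in> B"
proof -
  have sets [measurable_cong]: "sets \<mu> = sets borel"
    using haar by (simp add: haar_measure_def)
  have space: "space \<mu> = UNIV"
    using sets sets_eq_imp_space_eq by fastforce
  have transl: "emeasure \<mu> ((+) g ` A) = emeasure \<mu> A" if "A \<in> sets borel" for g A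
    using haar that by (simp add: haar_measure_def)
  \<comment> \<open>\<open>B\<close> is measurable only in the completion; its main part is a Borel
    subset of the same measure.\<close>
  define B' where "B' = main_part \<mu> B"
  have B': "B' \<in> sets \<mu>" "emeasure \<mu> B' \<noteq> 0"
    using B by (simp_all add: B'_def)
  have B'_sub: "B' \<subseteq> B"
    unfolding B'_def using main_part_null_part_Un[OF B(1)] by blast
  obtain \<F> :: "'g set set" where \<F>: "countable \<F>" "\<Union>\<F> = UNIV"
    "\<And>S. S \<in> \<F> \<Longrightarrow> open S" "\<And>S. S \<in> \<F> \<Longrightarrow> emeasure \<mu> S < \<infinity>"
    using haar_measure_cover[OF lc haar] by metis
  have "\<exists>S\<in>\<F>. emeasure \<mu> (S \<inter> B') \<noteq> 0"
  proof (rule ccontr)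
    assume "\<not> ?thesis"
    then have "(\<Union>S\<in>\<F>. S \<inter> B') \<in> null_sets \<mu>"
      using \<F> B' sets by (intro null_sets_UN') auto
    also have "(\<Union>S\<in>\<F>. S \<inter> B') = B'"
      using \<F>(2) by auto
    finally show False
      using B' by auto
  qed
  then obtain S where S: "S \<in> \<F>" "emeasure \<mu> (S \<inter> B') \<noteq> 0"
    by blast
  have oS: "open S" and fS: "emeasure \<mu> S < \<infinity>"
    using S \<F> by auto
  \<comment> \<open>Regularity is applied to a finite Borel measure, so \<mu> is cut down to a piece
    \<open>S\<close> of finite measure that meets \<open>B'\<close> in positive measure.\<close>
  define \<nu> where "\<nu> = density \<mu> (indicator S)"
  have sets_\<nu>: "sets \<nu> = sets borel"
    by (simp add: \<nu>_def sets)
  have S_sets: "S \<in> sets \<mu>"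
    using oS sets by auto
  have \<nu>: "emeasure \<nu> A = emeasure \<mu> (S \<inter> A)" if "A \<in> sets borel" for A
  proof -
    have "A \<in> sets \<mu>"
      using that sets by simp
    then show ?thesis
      using S_sets unfolding \<nu>_def by (subst emeasure_density)
        (auto simp: sets.Int indicator_inter_arith[symmetric] simp flip: nn_integral_indicator)
  qed
  have fin: "emeasure \<nu> (space \<nu>) \<noteq> \<infinity>"
    using \<nu>[of UNIV] fS space by (simp add: \<nu>_def)
  have C: "S \<inter> B' \<in> sets borel"
    using B' oS sets by auto
  have "0 < emeasure \<nu> (S \<inter> B')"
    using \<nu>[OF C] S by (simp add: Int_assoc[symmetric] zero_less_iff_neq_zero)
  then have "\<exists>K\<in>{K. K \<subseteq> S \<inter> B' \<and> compact K}. 0 < emeasure \<nu> K"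
    unfolding inner_regular[OF sets_\<nu> fin C] less_SUP_iff .
  then obtain K where K: "compact K" "K \<subseteq> S \<inter> B'" "0 < emeasure \<nu> K"
    by blast
  have K_sets: "K \<in> sets borel"
    using K borel_compact by blast
  have \<nu>K: "emeasure \<nu> K = emeasure \<mu> K"
    using \<nu>[OF K_sets] K by (simp add: Int_absorb1)
  have finK: "emeasure \<mu> K < \<infinity>"
    using haar K by (auto simp: haar_measure_def)
  have less: "emeasure \<nu> K < 2 * emeasure \<mu> K"
    using K(3) finK unfolding \<nu>K
    by (metis add.right_neutral ennreal_add_left_cancel_less infinity_ennreal_def less_top mult_2)
  then have "\<exists>U\<in>{U. K \<subseteq> U \<and> open U}. emeasure \<nu> U < 2 * emeasure \<mu> K"
    unfolding outer_regular[OF sets_\<nu> fin K_sets] by (simp only: INF_less_iff)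
  then obtain U where U: "K \<subseteq> U" "open U" "emeasure \<nu> U < 2 * emeasure \<mu> K"
    by blast
  \<comment> \<open>The translate has to stay in \<open>S\<close> too, because \<nu> controls only
    the part of \<open>U\<close> that lies in \<open>S\<close>.\<close>
  have "\<forall>\<^sub>F g in nhds 0. (+) g ` K \<subseteq> S \<inter> U"
    using K U oS by (intro eventually_translate_subset) auto
  then show ?thesis
  proof eventually_elim
    case (elim g)
    have gK: "compact ((+) g ` K)"
      by (intro compact_continuous_image K continuous_intros)
    have "(+) g ` K \<inter> K \<noteq> {}"
    proof
      assume disj: "(+) g ` K \<inter> K = {}"
      have "2 * emeasure \<mu> K = emeasure \<mu> ((+) g ` K) + emeasure \<mu> K"
        by (simp add: transl[OF K_sets] mult_2)
      also have "\<dots> = emeasure \<mu> ((+) g ` K \<union> K)"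
        using disj K_sets gK borel_compact sets by (intro plus_emeasure) auto
      also have "\<dots> \<le> emeasure \<mu> (S \<inter> U)"
        using elim K U oS sets by (intro emeasure_mono) auto
      also have "\<dots> = emeasure \<nu> U"
        using U by (simp add: \<nu>)
      finally show False
        using U by simp
    qed
    then show ?case
      using K(2) B'_sub by blast
  qed
qed

section \<open>The cocycle near the identity\<close>

text \<open>The map (a, b) \<mapsto> - a + b is continuous with value 0 at (h, h), so each
  \<open>h\<close> has a suitable neighbourhood. Lindelof leaves countably many, so that null sets
  indexed by them have a null union.\<close>

lemma small_differences_cover:
  fixes W :: "'h::{topological_group_add, second_countable_topology} set"
  assumes "open W" "0 \<in> W"
  obtains \<O> :: "'h set set" where "countable \<O>" "\<Union>\<O> = UNIV" "\<And>V. V \<in> \<O> \<Longrightarrow> open V"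
    "\<And>V a b. V \<in> \<O> \<Longrightarrow> a \<in> V \<Longrightarrow> b \<in> V \<Longrightarrow> - a + b \<in> W"
proof -
  let ?\<O> = "{V. open V \<and> (\<forall>a\<in>V. \<forall>b\<in>V. - a + b \<in> W)}"
  have "\<exists>V\<in>?\<O>. h \<in> V" for h
  proof -
    have "((\<lambda>z. - fst z + snd z) \<longlongrightarrow> - h + h) (nhds h \<times>\<^sub>F nhds h)"
      by (intro tendsto_intros filterlim_fst filterlim_snd)
    then have "\<forall>\<^sub>F z in nhds h \<times>\<^sub>F nhds h. - fst z + snd z \<in> W"
      using assms by (intro topological_tendstoD) auto
    then obtain P Q where "eventually P (nhds h)" "eventually Q (nhds h)"
      and PQ: "\<And>x y. P x \<Longrightarrow> Q y \<Longrightarrow> - x + y \<in> W"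
      unfolding eventually_prod_filter by auto
    then have "\<forall>\<^sub>F x in nhds h. P x \<and> Q x"
      by (simp add: eventually_conj)
    then obtain V where "open V" "h \<in> V" "\<forall>x\<in>V. P x \<and> Q x"
      unfolding eventually_nhds by auto
    then show ?thesis
      using PQ by (intro bexI[of _ V]) auto
  qed
  then have "h \<in> \<Union>?\<O>" for h
    unfolding Union_iff .
  then have "\<Union>?\<O> = UNIV"
    by (rule UNIV_eq_I[symmetric])
  moreover have "\<And>V. V \<in> ?\<O> \<Longrightarrow> open V"
    by simp
  then obtain \<O> where "\<O> \<subseteq> ?\<O>" "countable \<O>" "\<Union>\<O> = \<Union>?\<O>"
    by (rule Lindelof)
  ultimately show thesis
    by (intro that[of \<O>]) (simp_all add: subset_iff)
qed

text \<open>For an action this is sequential continuity at \<open>(0, x0)\<close>, as the cocycle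
  identity then forces \<open>c (0, x0) = 0\<close>.\<close>

lemma cocycle_tendsto_0:
  fixes \<alpha> :: "'g::{topological_group_add, polish_space} \<Rightarrow> 'x::topological_space \<Rightarrow> 'x"
    and c :: "'g \<times> 'x \<Rightarrow> 'h::{topological_group_add, second_countable_topology}"
    and \<mu> :: "'g measure"
  assumes lc: "locally_compact_space (euclidean :: 'g topology)"
    and coc: "cocycle \<alpha> c"
    and cont: "\<And>g. continuous_on UNIV (\<lambda>x. c (g, x))"
    and haar: "haar_measure \<mu>"
    and meas: "\<And>x. haar_measurable \<mu> (\<lambda>g. c (g, x))"
    and p: "p \<longlonglongrightarrow> 0" and x: "x \<longlonglongrightarrow> x0" and y: "(\<lambda>n. \<alpha> (p n) (x n)) \<longlonglongrightarrow> x0"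
  shows "(\<lambda>n. c (p n, x n)) \<longlonglongrightarrow> 0"
proof (rule topological_tendstoI)
  fix W :: "'h set"
  assume "open W" "0 \<in> W"
  then obtain \<O> :: "'h set set" where \<O>: "countable \<O>" "\<Union>\<O> = UNIV" "\<And>V. V \<in> \<O> \<Longrightarrow> open V"
    "\<And>V a b. V \<in> \<O> \<Longrightarrow> a \<in> V \<Longrightarrow> b \<in> V \<Longrightarrow> - a + b \<in> W"
    using small_differences_cover by metis
  define y where "y n = \<alpha> (p n) (x n)" for n
  \<comment> \<open>The cocycle identity at \<open>- (p n + k)\<close> and \<open>p n\<close>, whose
    sum is \<open>- k\<close>. The left side is free of \<open>k\<close>, so \<open>k\<close> may be
    chosen depending on \<open>n\<close>.\<close>
  have c_eq: "c (p n, x n) = - c (- (p n + k), y n) + c (- k, x n)" for n k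
  proof -
    have "c (- (p n + k) + p n, x n) = c (- (p n + k), y n) + c (p n, x n)"
      using coc by (simp add: cocycle_def y_def)
    moreover have "- (p n + k) + p n = - k"
      by (simp add: minus_add add.assoc)
    ultimately show ?thesis
      by (simp add: add.assoc[symmetric])
  qed
  define B where "B V N = {k. \<forall>n\<ge>N. c (- k, x n) \<in> V \<and> c (- k, y n) \<in> V}"
    for V and N :: nat
  have B_sets: "B V N \<in> sets (completion \<mu>)" if "V \<in> \<O>" for V N
  proof -
    \<comment> \<open>Measurability is assumed in the group variable, while \<open>k\<close> enters
      as \<open>- k\<close>; hence the inversion lemma.\<close>
    have *: "{k. c (- k, z) \<in> V} \<in> sets (completion \<mu>)" for z
    proof -
      have "(\<lambda>g. c (g, z)) -` V \<in> sets (completion \<mu>)"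
        using meas \<O>(3)[OF that] by (auto simp: haar_measurable_def)
      from haar_completion_uminus[OF lc haar this] show ?thesis
        by (simp add: vimage_def)
    qed
    have "B V N = (\<Inter>n\<in>{N..}. {k. c (- k, x n) \<in> V} \<inter> {k. c (- k, y n) \<in> V})"
      by (auto simp: B_def)
    then show ?thesis
      using * by (auto intro!: sets.countable_INT'' sets.countable_INT' sets.Int)
  qed
  have cover: "(\<Union>(V, N)\<in>\<O> \<times> UNIV. B V N) = UNIV"
  proof -
    have "\<exists>V\<in>\<O>. \<exists>N. k \<in> B V N" for k
    proof -
      have "c (- k, x0) \<in> \<Union>\<O>"
        by (simp add: \<O>(2))
      then obtain V where V: "V \<in> \<O>" "c (- k, x0) \<in> V"
        by (rule UnionE)
      have "(\<lambda>n. c (- k, z n)) \<longlonglongrightarrow> c (- k, x0)" if "z \<longlonglongrightarrow> x0" for z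
        using continuous_on_tendsto_compose[OF cont that] by simp
      then have "\<forall>\<^sub>F n in sequentially. c (- k, x n) \<in> V \<and> c (- k, y n) \<in> V"
        using x \<open>(\<lambda>n. \<alpha> (p n) (x n)) \<longlonglongrightarrow> x0\<close> V \<O>(3)
        unfolding y_def[symmetric] by (intro eventually_conj topological_tendstoD) auto
      then show ?thesis
        using V by (auto simp: B_def eventually_sequentially)
    qed
    then show ?thesis
      by blast
  qed
  \<comment> \<open>Otherwise the whole group would be a countable union of null sets.\<close>
  have "\<exists>V\<in>\<O>. \<exists>N. emeasure (completion \<mu>) (B V N) \<noteq> 0"
  proof (rule ccontr)
    assume "\<not> ?thesis"
    then have "(\<Union>(V, N)\<in>\<O> \<times> UNIV. B V N) \<in> null_sets (completion \<mu>)"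
      using \<O>(1) B_sets by (intro null_sets_UN') auto
    moreover have "UNIV \<in> sets \<mu>"
      using haar by (simp add: haar_measure_def)
    ultimately show False
      using haar unfolding cover by (simp add: haar_measure_def null_sets_def)
  qed
  then obtain V N where V: "V \<in> \<O>" and N: "emeasure (completion \<mu>) (B V N) \<noteq> 0"
    by blast
  have "\<forall>\<^sub>F n in sequentially. \<exists>k\<in>B V N. p n + k \<in> B V N"
    using haar_steinhaus[OF lc haar B_sets[OF V] N] p by (rule eventually_compose_filterlim)
  then show "\<forall>\<^sub>F n in sequentially. c (p n, x n) \<in> W"
    using eventually_ge_at_top[of N]
  proof eventually_elim
    case (elim n)
    then obtain k where k: "k \<in> B V N" "p n + k \<in> B V N"
      by blast
    \<comment> \<open>The point \<open>p n + k\<close> of \<open>B V N\<close> puts the value at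
      \<open>y n\<close> into \<open>V\<close>, the point \<open>k\<close> the value at
      \<open>x n\<close>.\<close>
    show ?case
      unfolding c_eq[of n k] using k elim(2) by (intro \<O>(4)[OF V]) (auto simp: B_def)
  qed
qed

section \<open>Continuity at an arbitrary point\<close>

theorem theorem1p6:
  fixes \<alpha> :: "'g::{topological_group_add, polish_space} \<Rightarrow> 'x::polish_space \<Rightarrow> 'x"
    and c :: "'g \<times> 'x \<Rightarrow> 'h::{topological_group_add, polish_space}"
    and \<mu> :: "'g measure"
  assumes "locally_compact_space (euclidean :: 'g topology)"
    and "locally_compact_space (euclidean :: 'h topology)"
    and "locally_compact_space (euclidean :: 'x topology)"
    and "continuous_action \<alpha>"
    and "cocycle \<alpha> c"
    and "\<And>g. continuous_on UNIV (\<lambda>x. c (g, x))"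
    and "haar_measure \<mu>"
    and "\<And>x. haar_measurable \<mu> (\<lambda>g. c (g, x))"
  shows "continuous_on UNIV c"
  unfolding continuous_on_sequentially
proof (intro allI ballI impI, elim conjE)
  fix z :: "nat \<Rightarrow> 'g \<times> 'x" and z0
  assume z: "z \<longlonglongrightarrow> z0"
  obtain g x where z0: "z0 = (g, x)"
    by fastforce
  \<comment> \<open>Since \<open>fst (z n) = p n + g\<close>, the cocycle identity splits
    \<open>c (z n)\<close> into a factor near the identity, based at \<open>u n\<close>, and
    \<open>c (g, snd (z n))\<close>.\<close>
  define p where "p n = fst (z n) - g" for n
  define u where "u n = \<alpha> g (snd (z n))" for n
  have gz: "(\<lambda>n. fst (z n)) \<longlonglongrightarrow> g" and xz: "(\<lambda>n. snd (z n)) \<longlonglongrightarrow> x"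
    using tendsto_fst[OF z] tendsto_snd[OF z] by (auto simp: z0)
  have add: "\<alpha> (h + k) w = \<alpha> h (\<alpha> k w)" for h k w
    using assms(4) by (simp add: continuous_action_def)
  have \<alpha>: "(\<lambda>n. \<alpha> (h n) (w n)) \<longlonglongrightarrow> \<alpha> h0 w0" if "h \<longlonglongrightarrow> h0" "w \<longlonglongrightarrow> w0" for h w h0 w0
  proof -
    have "continuous_on UNIV (\<lambda>(g, x). \<alpha> g x)"
      using assms(4) by (simp add: continuous_action_def)
    from continuous_on_tendsto_compose[OF this tendsto_Pair[OF that]] show ?thesis
      by simp
  qed
  have p: "p \<longlonglongrightarrow> 0"
    using tendsto_diff[OF gz tendsto_const, of g] by (simp add: p_def[abs_def])
  have u: "u \<longlonglongrightarrow> \<alpha> g x"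
    unfolding u_def by (intro \<alpha> tendsto_const xz)
  \<comment> \<open>The limit arises as \<open>\<alpha> 0 (\<alpha> g x)\<close>, which the action
    law collapses.\<close>
  have "(\<lambda>n. \<alpha> (p n) (u n)) \<longlonglongrightarrow> \<alpha> g x"
    using \<alpha>[OF p u] by (simp flip: add)
  then have "(\<lambda>n. c (p n, u n)) \<longlonglongrightarrow> 0"
    by (rule cocycle_tendsto_0[OF assms(1,5,6,7,8) p u])
  moreover have "(\<lambda>n. c (g, snd (z n))) \<longlonglongrightarrow> c (g, x)"
    using continuous_on_tendsto_compose[OF assms(6) xz] by simp
  ultimately have "(\<lambda>n. c (p n, u n) + c (g, snd (z n))) \<longlonglongrightarrow> 0 + c (g, x)"
    by (rule tendsto_add)
  moreover have "c (p n, u n) + c (g, snd (z n)) = c (z n)" for n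
  proof -
    have "c (p n + g, snd (z n)) = c (p n, u n) + c (g, snd (z n))"
      using assms(5) by (simp add: cocycle_def u_def)
    then show ?thesis
      by (simp add: p_def)
  qed
  ultimately show "(c \<circ> z) \<longlonglongrightarrow> c z0"
    by (simp add: z0 comp_def)
qed

end
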